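(* The model category $\mathrm{DblCat}_{\mathrm{ctr}}$ is a localization of every model structure on $\mathrm{DblCat}$ whose trivial fibrations are exactly the canonical trivial fibrations.
   Context: **Double categories.** All double categories are small and strict (internal categories in $\mathrm{Cat}$): they have objects, horizontal morphisms, vertical morphisms, and squares, each square having a top and a bottom horizontal morphism and a left and a right vertical morphism. $\mathrm{DblCat}$ is the category of double categories and double functors; $\mathbf 1$ is the terminal double category. $\alpha\vert\beta$ is the horizontal composite ($\alpha$ to the left of $\beta$), $\frac{\alpha}{\beta}$ the vertical composite ($\alpha$ above $\beta$); $e_f$ is the vertical identity square at a horizontal morphism $f$, $\mathrm{id}_u$ the horizontal identity square at a vertical morphism $u$. A double functor is a *canonical trivial fibration* if it is surjective on objects, full on horizontal and on vertical morphisms, and fully faithful on squares (bijective on squares with any given boundary in the source). **Gregarious equivalences.** $\mathbf H\mathbb A$ is the underlying horizontal 2-category of $\mathbb A$ (objects, horizontal morphisms, and as 2-morphisms the squares whose left and right sides are identities), $\mathbf V\mathbb A$ the underlying vertical 2-category (directions exchanged). A *companion pair* $(f,u,\varphi,\psi)$ consists of a horizontal morphism $f\colon A\to B$, a vertical morphism $u$ from $A$ to $B$, a square $\varphi$ with top $f$, left $u$, bottom and right identities at $B$, and a square $\psi$ with top and left identities at $A$, bottom $f$, right $u$, such that $\psi\vert\varphi=e_f$ and $\frac{\psi}{\varphi}=\mathrm{id}_u$. $\mathbf R\mathbb A$ is the 2-category with the objects of $\mathbb A$, companion pairs as morphisms, and as 2-morphisms $(f,u,\varphi,\psi)\Rightarrow(f',u',\varphi',\psi')$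 the squares with top $f$, bottom $f'$ and identity left and right sides. A *gregarious equivalence* is a companion pair that is an equivalence in $\mathbf R\mathbb A$. A double functor $F\colon\mathbb A\to\mathbb B$ is a *gregarious double equivalence* if every object $B\in\mathbb B$ admits a gregarious equivalence $FA\to B$ for some $A\in\mathbb A$, the 2-functors $\mathbf HF$ and $\mathbf VF$ are essentially full on morphisms, and $F$ is fully faithful on squares. **Model structure.** $\mathrm{DblCat}_{\mathrm{ctr}}$ is the (existing, unique, cofibrantly generated) model structure on $\mathrm{DblCat}$ whose trivial fibrations are the canonical ones and whose fibrant objects are the double categories $\mathbb A$ such that $\mathbb A\to\mathbf 1$ is a gregarious double equivalence. Its weak equivalences between fibrant objects are the gregarious double equivalences. **Localization.** A *localization* of a model category $\mathcal M$ is another model structure $\mathcal M_{\mathrm{loc}}$ on the same underlying category with the same trivial fibrations, such that the identity adjunction $\mathrm{id}\colon\mathcal M\rightleftarrows\mathcal M_{\mathrm{loc}}\colon\mathrm{id}$ (left adjoint from $\mathcal M$ to $\mathcal M_{\mathrm{loc}}$) is a Quillen pair whose derived counit is a weak equivalence in $\mathcal M_{\mathrm{loc}}$. *)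

theory Defs
  imports "HOL-Library.FuncSet"
begin

section \<open>Categories\<close>

text \<open>Composition is written in diagrammatic order: \<open>Cmp C f g\<close> is \<open>f\<close> followed by \<open>g\<close>.\<close>

record ('o, 'm) cat =
  Ob :: "'o set"
  Ar :: "'m set"
  Dom :: "'m \<Rightarrow> 'o"
  Cod :: "'m \<Rightarrow> 'o"
  Id :: "'o \<Rightarrow> 'm"
  Cmp :: "'m \<Rightarrow> 'm \<Rightarrow> 'm"

definition Hom :: "('o, 'm) cat \<Rightarrow> 'o \<Rightarrow> 'o \<Rightarrow> 'm set" where
  "Hom C x y = {f \<in> Ar C. Dom C f = x \<and> Cod C f = y}"

definition is_category :: "('o, 'm) cat \<Rightarrow> bool" where
  "is_category C \<longleftrightarrow>
     (\<forall>f\<in>Ar C. Dom C f \<in> Ob C \<and> Cod C f \<in> Ob C) \<and>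
     (\<forall>x\<in>Ob C. Id C x \<in> Hom C x x) \<and>
     (\<forall>f\<in>Ar C. \<forall>g\<in>Ar C. Cod C f = Dom C g \<longrightarrow> Cmp C f g \<in> Hom C (Dom C f) (Cod C g)) \<and>
     (\<forall>f\<in>Ar C. Cmp C (Id C (Dom C f)) f = f \<and> Cmp C f (Id C (Cod C f)) = f) \<and>
     (\<forall>f\<in>Ar C. \<forall>g\<in>Ar C. \<forall>h\<in>Ar C. Cod C f = Dom C g \<longrightarrow> Cod C g = Dom C h \<longrightarrow>
        Cmp C (Cmp C f g) h = Cmp C f (Cmp C g h))"

definition is_functor ::
  "('o, 'm) cat \<Rightarrow> ('p, 'n) cat \<Rightarrow> ('o \<Rightarrow> 'p) \<Rightarrow> ('m \<Rightarrow> 'n) \<Rightarrow> bool" where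
  "is_functor C D fo fa \<longleftrightarrow>
     (\<forall>x\<in>Ob C. fo x \<in> Ob D \<and> fa (Id C x) = Id D (fo x)) \<and>
     (\<forall>f\<in>Ar C. fa f \<in> Hom D (fo (Dom C f)) (fo (Cod C f))) \<and>
     (\<forall>f\<in>Ar C. \<forall>g\<in>Ar C. Cod C f = Dom C g \<longrightarrow> fa (Cmp C f g) = Cmp D (fa f) (fa g))"

definition isomorphic :: "('o, 'm) cat \<Rightarrow> 'o \<Rightarrow> 'o \<Rightarrow> bool" where
  "isomorphic C x y \<longleftrightarrow>
     (\<exists>f\<in>Hom C x y. \<exists>g\<in>Hom C y x. Cmp C f g = Id C x \<and> Cmp C g f = Id C y)"

definition terminal :: "('o, 'm) cat \<Rightarrow> 'o \<Rightarrow> bool" where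
  "terminal C t \<longleftrightarrow> t \<in> Ob C \<and> (\<forall>x\<in>Ob C. \<exists>!f. f \<in> Hom C x t)"

definition initial :: "('o, 'm) cat \<Rightarrow> 'o \<Rightarrow> bool" where
  "initial C i \<longleftrightarrow> i \<in> Ob C \<and> (\<forall>x\<in>Ob C. \<exists>!f. f \<in> Hom C i x)"


section \<open>Model structures\<close>

definition has_lifting :: "('o, 'm) cat \<Rightarrow> 'm \<Rightarrow> 'm \<Rightarrow> bool" where
  "has_lifting C l r \<longleftrightarrow>
     (\<forall>u \<in> Hom C (Dom C l) (Dom C r). \<forall>v \<in> Hom C (Cod C l) (Cod C r).
        Cmp C u r = Cmp C l v \<longrightarrow>
        (\<exists>d \<in> Hom C (Cod C l) (Dom C r). Cmp C l d = u \<and> Cmp C d r = v))"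

definition weak_factorization_system :: "('o, 'm) cat \<Rightarrow> 'm set \<Rightarrow> 'm set \<Rightarrow> bool" where
  "weak_factorization_system C L R \<longleftrightarrow>
     L = {l \<in> Ar C. \<forall>r\<in>R. has_lifting C l r} \<and>
     R = {r \<in> Ar C. \<forall>l\<in>L. has_lifting C l r} \<and>
     (\<forall>f\<in>Ar C. \<exists>l\<in>L. \<exists>r\<in>R. Cod C l = Dom C r \<and> Cmp C l r = f)"

record 'm model =
  weq :: "'m set"
  cof :: "'m set"
  fib :: "'m set"

abbreviation tcof :: "'m model \<Rightarrow> 'm set" where "tcof M \<equiv> cof M \<inter> weq M"
abbreviation tfib :: "'m model \<Rightarrow> 'm set" where "tfib M \<equiv> fib M \<inter> weq M"

text \<open>Closure of the three classes under retracts follows from these axioms.\<close>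

definition model_structure :: "('o, 'm) cat \<Rightarrow> 'm model \<Rightarrow> bool" where
  "model_structure C M \<longleftrightarrow>
     weq M \<subseteq> Ar C \<and>
     (\<forall>f\<in>Ar C. \<forall>g\<in>Ar C. Cod C f = Dom C g \<longrightarrow>
        (f \<in> weq M \<and> g \<in> weq M \<longrightarrow> Cmp C f g \<in> weq M) \<and>
        (f \<in> weq M \<and> Cmp C f g \<in> weq M \<longrightarrow> g \<in> weq M) \<and>
        (g \<in> weq M \<and> Cmp C f g \<in> weq M \<longrightarrow> f \<in> weq M)) \<and>
     weak_factorization_system C (cof M) (tfib M) \<and>
     weak_factorization_system C (tcof M) (fib M)"

definition fibrant :: "('o, 'm) cat \<Rightarrow> 'm model \<Rightarrow> 'o \<Rightarrow> bool" where
  "fibrant C M x \<longleftrightarrow> (\<exists>t f. terminal C t \<and> f \<in> Hom C x t \<and> f \<in> fib M)"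

definition cofibrant :: "('o, 'm) cat \<Rightarrow> 'm model \<Rightarrow> 'o \<Rightarrow> bool" where
  "cofibrant C M x \<longleftrightarrow> (\<exists>i f. initial C i \<and> f \<in> Hom C i x \<and> f \<in> cof M)"


section \<open>Quillen pairs and localizations\<close>

record ('o, 'm, 'p, 'n) adj =
  left_ob :: "'o \<Rightarrow> 'p"
  left_ar :: "'m \<Rightarrow> 'n"
  right_ob :: "'p \<Rightarrow> 'o"
  right_ar :: "'n \<Rightarrow> 'm"
  unit :: "'o \<Rightarrow> 'm"
  counit :: "'p \<Rightarrow> 'n"

definition adjunction ::
  "('o, 'm) cat \<Rightarrow> ('p, 'n) cat \<Rightarrow> ('o, 'm, 'p, 'n) adj \<Rightarrow> bool" where
  "adjunction C D J \<longleftrightarrow>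
     is_functor C D (left_ob J) (left_ar J) \<and>
     is_functor D C (right_ob J) (right_ar J) \<and>
     (\<forall>x\<in>Ob C. unit J x \<in> Hom C x (right_ob J (left_ob J x))) \<and>
     (\<forall>y\<in>Ob D. counit J y \<in> Hom D (left_ob J (right_ob J y)) y) \<and>
     (\<forall>f\<in>Ar C. Cmp C f (unit J (Cod C f)) = Cmp C (unit J (Dom C f)) (right_ar J (left_ar J f))) \<and>
     (\<forall>g\<in>Ar D. Cmp D (left_ar J (right_ar J g)) (counit J (Cod D g)) =
                Cmp D (counit J (Dom D g)) g) \<and>
     (\<forall>x\<in>Ob C. Cmp D (left_ar J (unit J x)) (counit J (left_ob J x)) = Id D (left_ob J x)) \<and>
     (\<forall>y\<in>Ob D. Cmp C (unit J (right_ob J y)) (right_ar J (counit J y)) = Id C (right_ob J y))"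

definition quillen_pair ::
  "('o, 'm) cat \<Rightarrow> 'm model \<Rightarrow> ('p, 'n) cat \<Rightarrow> 'n model \<Rightarrow> ('o, 'm, 'p, 'n) adj \<Rightarrow> bool" where
  "quillen_pair C M D N J \<longleftrightarrow>
     adjunction C D J \<and> left_ar J ` cof M \<subseteq> cof N \<and> left_ar J ` tcof M \<subseteq> tcof N"

text \<open>The component of the derived counit at a fibrant object \<open>y\<close> is
  \<open>L Q \<rightarrow> L R y \<rightarrow> y\<close>, where \<open>q : Q \<rightarrow> R y\<close> is a cofibrant replacement. Being a weak
  equivalence does not depend on the replacement chosen.\<close>

definition derived_counit_weq ::
  "('o, 'm) cat \<Rightarrow> 'm model \<Rightarrow> ('p, 'n) cat \<Rightarrow> 'n model \<Rightarrow> ('o, 'm, 'p, 'n) adj \<Rightarrow> bool" where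
  "derived_counit_weq C M D N J \<longleftrightarrow>
     (\<forall>y\<in>Ob D. fibrant D N y \<longrightarrow>
        (\<forall>q\<in>tfib M. cofibrant C M (Dom C q) \<and> Cod C q = right_ob J y \<longrightarrow>
           Cmp D (left_ar J q) (counit J y) \<in> weq N))"

definition identity_adjunction :: "('o, 'm) cat \<Rightarrow> ('o, 'm, 'o, 'm) adj" where
  "identity_adjunction C =
     \<lparr>left_ob = (\<lambda>x. x), left_ar = (\<lambda>f. f), right_ob = (\<lambda>x. x), right_ar = (\<lambda>f. f),
      unit = Id C, counit = Id C\<rparr>"

definition is_localization :: "('o, 'm) cat \<Rightarrow> 'm model \<Rightarrow> 'm model \<Rightarrow> bool" where
  "is_localization C M Mloc \<longleftrightarrow>
     model_structure C M \<and> model_structure C Mloc \<and> tfib Mloc = tfib M \<and>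
     quillen_pair C M C Mloc (identity_adjunction C) \<and>
     derived_counit_weq C M C Mloc (identity_adjunction C)"


section \<open>Double categories\<close>

text \<open>A double category is presented by four categories:
  \<^item> \<open>hor\<close>: objects and horizontal morphisms;
  \<^item> \<open>ver\<close>: objects and vertical morphisms;
  \<^item> \<open>hsq\<close>: vertical morphisms and squares, a square going from its left to its right side,
    with composition \<open>\<alpha> | \<beta>\<close> and identities \<open>id\<^sub>u\<close>;
  \<^item> \<open>vsq\<close>: horizontal morphisms and squares, a square going from its top to its bottom,
    with composition \<open>\<alpha>\<close> above \<open>\<beta>\<close> and identities \<open>e\<^sub>f\<close>.

  As an internal category in \<open>Cat\<close>, its category of objects is \<open>ver\<close>, its category of
  morphisms is \<open>vsq\<close>, and the operations of \<open>hor\<close> and \<open>hsq\<close> are the object and arrow parts of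
  the structure functors.\<close>

record 'a dbl =
  hor :: "('a, 'a) cat"
  ver :: "('a, 'a) cat"
  hsq :: "('a, 'a) cat"
  vsq :: "('a, 'a) cat"

abbreviation Obj :: "'a dbl \<Rightarrow> 'a set" where "Obj A \<equiv> Ob (hor A)"
abbreviation HMor :: "'a dbl \<Rightarrow> 'a set" where "HMor A \<equiv> Ar (hor A)"
abbreviation VMor :: "'a dbl \<Rightarrow> 'a set" where "VMor A \<equiv> Ar (ver A)"
abbreviation Sq :: "'a dbl \<Rightarrow> 'a set" where "Sq A \<equiv> Ar (vsq A)"

abbreviation sq_left :: "'a dbl \<Rightarrow> 'a \<Rightarrow> 'a" where "sq_left A \<equiv> Dom (hsq A)"
abbreviation sq_right :: "'a dbl \<Rightarrow> 'a \<Rightarrow> 'a" where "sq_right A \<equiv> Cod (hsq A)"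
abbreviation sq_top :: "'a dbl \<Rightarrow> 'a \<Rightarrow> 'a" where "sq_top A \<equiv> Dom (vsq A)"
abbreviation sq_bot :: "'a dbl \<Rightarrow> 'a \<Rightarrow> 'a" where "sq_bot A \<equiv> Cod (vsq A)"

definition horizontally_composable_pairs :: "'a dbl \<Rightarrow> ('a \<times> 'a, 'a \<times> 'a) cat" where
  "horizontally_composable_pairs A =
     \<lparr>Ob = {(f, g). f \<in> HMor A \<and> g \<in> HMor A \<and> Cod (hor A) f = Dom (hor A) g},
      Ar = {(\<alpha>, \<beta>). \<alpha> \<in> Sq A \<and> \<beta> \<in> Sq A \<and> sq_right A \<alpha> = sq_left A \<beta>},
      Dom = map_prod (sq_top A) (sq_top A),
      Cod = map_prod (sq_bot A) (sq_bot A),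
      Id = map_prod (Id (vsq A)) (Id (vsq A)),
      Cmp = (\<lambda>(\<alpha>, \<beta>) (\<gamma>, \<delta>). (Cmp (vsq A) \<alpha> \<gamma>, Cmp (vsq A) \<beta> \<delta>))\<rparr>"

definition double_category :: "'a dbl \<Rightarrow> bool" where
  "double_category A \<longleftrightarrow>
     is_category (hor A) \<and> is_category (ver A) \<and> is_category (hsq A) \<and> is_category (vsq A) \<and>
     Ob (ver A) = Ob (hor A) \<and> Ob (hsq A) = Ar (ver A) \<and> Ob (vsq A) = Ar (hor A) \<and>
     Ar (hsq A) = Ar (vsq A) \<and>
     is_functor (vsq A) (ver A) (Dom (hor A)) (Dom (hsq A)) \<and>
     is_functor (vsq A) (ver A) (Cod (hor A)) (Cod (hsq A)) \<and>
     is_functor (ver A) (vsq A) (Id (hor A)) (Id (hsq A)) \<and>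
     is_functor (horizontally_composable_pairs A) (vsq A)
       (\<lambda>(f, g). Cmp (hor A) f g) (\<lambda>(\<alpha>, \<beta>). Cmp (hsq A) \<alpha> \<beta>)"

record 'a dfun =
  source :: "'a dbl"
  target :: "'a dbl"
  on_ob :: "'a \<Rightarrow> 'a"
  on_hor :: "'a \<Rightarrow> 'a"
  on_ver :: "'a \<Rightarrow> 'a"
  on_sq :: "'a \<Rightarrow> 'a"

text \<open>The component maps are normalised to \<open>undefined\<close> outside the carriers, so that
  equality of records is equality of double functors.\<close>

definition double_functor :: "'a dfun \<Rightarrow> bool" where
  "double_functor F \<longleftrightarrow>
     is_functor (hor (source F)) (hor (target F)) (on_ob F) (on_hor F) \<and>
     is_functor (ver (source F)) (ver (target F)) (on_ob F) (on_ver F) \<and>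
     is_functor (hsq (source F)) (hsq (target F)) (on_ver F) (on_sq F) \<and>
     is_functor (vsq (source F)) (vsq (target F)) (on_hor F) (on_sq F) \<and>
     on_ob F \<in> extensional (Obj (source F)) \<and>
     on_hor F \<in> extensional (HMor (source F)) \<and>
     on_ver F \<in> extensional (VMor (source F)) \<and>
     on_sq F \<in> extensional (Sq (source F))"

text \<open>\<open>\<U>\<close> is the collection of small sets. Every Grothendieck universe with an infinite element
  gives an instance (\<open>'a\<close> being its set of elements, and \<open>\<U>\<close> the subsets of \<open>'a\<close> of small
  cardinality), and so does \<open>\<U> = UNIV\<close> for every infinite type \<open>'a\<close>.\<close>

definition universe :: "'a set set \<Rightarrow> bool" where
  "universe \<U> \<longleftrightarrow>
     (\<exists>X\<in>\<U>. infinite X) \<and>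
     (\<forall>X\<in>\<U>. \<forall>Y. Y \<subseteq> X \<longrightarrow> Y \<in> \<U>) \<and>
     (\<forall>X\<in>\<U>. \<forall>f :: 'a \<Rightarrow> 'a. f ` X \<in> \<U>) \<and>
     (\<forall>I\<in>\<U>. \<forall>X :: 'a \<Rightarrow> 'a set. (\<forall>i\<in>I. X i \<in> \<U>) \<longrightarrow> (\<Union>i\<in>I. X i) \<in> \<U>)"

definition small :: "'a set set \<Rightarrow> 'a dbl \<Rightarrow> bool" where
  "small \<U> A \<longleftrightarrow> Obj A \<in> \<U> \<and> HMor A \<in> \<U> \<and> VMor A \<in> \<U> \<and> Sq A \<in> \<U>"

definition DblCat :: "'a set set \<Rightarrow> ('a dbl, 'a dfun) cat" where
  "DblCat \<U> =
     \<lparr>Ob = {A. double_category A \<and> small \<U> A},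
      Ar = {F. double_category (source F) \<and> small \<U> (source F) \<and>
               double_category (target F) \<and> small \<U> (target F) \<and> double_functor F},
      Dom = source,
      Cod = target,
      Id = (\<lambda>A. \<lparr>source = A, target = A,
                  on_ob = (\<lambda>x\<in>Obj A. x), on_hor = (\<lambda>f\<in>HMor A. f),
                  on_ver = (\<lambda>u\<in>VMor A. u), on_sq = (\<lambda>\<alpha>\<in>Sq A. \<alpha>)\<rparr>),
      Cmp = (\<lambda>F G. \<lparr>source = source F, target = target G,
                     on_ob = compose (Obj (source F)) (on_ob G) (on_ob F),
                     on_hor = compose (HMor (source F)) (on_hor G) (on_hor F),
                     on_ver = compose (VMor (source F)) (on_ver G) (on_ver F),
                     on_sq = compose (Sq (source F)) (on_sq G) (on_sq F)\<rparr>)\<rparr>"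


section \<open>Canonical trivial fibrations\<close>

definition squares_with_boundary :: "'a dbl \<Rightarrow> 'a \<Rightarrow> 'a \<Rightarrow> 'a \<Rightarrow> 'a \<Rightarrow> 'a set" where
  "squares_with_boundary A f g u v =
     {\<alpha> \<in> Sq A. sq_top A \<alpha> = f \<and> sq_bot A \<alpha> = g \<and> sq_left A \<alpha> = u \<and> sq_right A \<alpha> = v}"

definition is_boundary :: "'a dbl \<Rightarrow> 'a \<Rightarrow> 'a \<Rightarrow> 'a \<Rightarrow> 'a \<Rightarrow> bool" where
  "is_boundary A f g u v \<longleftrightarrow>
     f \<in> HMor A \<and> g \<in> HMor A \<and> u \<in> VMor A \<and> v \<in> VMor A \<and>
     Dom (hor A) f = Dom (ver A) u \<and> Cod (hor A) f = Dom (ver A) v \<and>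
     Dom (hor A) g = Cod (ver A) u \<and> Cod (hor A) g = Cod (ver A) v"

definition fully_faithful_on_squares :: "'a dfun \<Rightarrow> bool" where
  "fully_faithful_on_squares F \<longleftrightarrow>
     (\<forall>f g u v. is_boundary (source F) f g u v \<longrightarrow>
        bij_betw (on_sq F) (squares_with_boundary (source F) f g u v)
          (squares_with_boundary (target F) (on_hor F f) (on_hor F g) (on_ver F u) (on_ver F v)))"

definition full :: "('o, 'm) cat \<Rightarrow> ('p, 'n) cat \<Rightarrow> ('o \<Rightarrow> 'p) \<Rightarrow> ('m \<Rightarrow> 'n) \<Rightarrow> bool" where
  "full C D fo fa \<longleftrightarrow> (\<forall>x\<in>Ob C. \<forall>y\<in>Ob C. Hom D (fo x) (fo y) \<subseteq> fa ` Hom C x y)"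

definition canonical_trivial_fibration :: "'a dfun \<Rightarrow> bool" where
  "canonical_trivial_fibration F \<longleftrightarrow>
     on_ob F ` Obj (source F) = Obj (target F) \<and>
     full (hor (source F)) (hor (target F)) (on_ob F) (on_hor F) \<and>
     full (ver (source F)) (ver (target F)) (on_ob F) (on_ver F) \<and>
     fully_faithful_on_squares F"

definition canonical_trivial_fibrations :: "'a set set \<Rightarrow> 'a dfun set" where
  "canonical_trivial_fibrations \<U> = {F \<in> Ar (DblCat \<U>). canonical_trivial_fibration F}"


section \<open>Underlying 2-categories\<close>

text \<open>\<open>cells1\<close> consists of the objects and 1-morphisms, \<open>cells2\<close> of the 1-morphisms and
  2-morphisms under vertical composition; \<open>hcmp2\<close> is horizontal composition of 2-morphisms.\<close>

record ('o, 'm, 't) twocat =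
  cells1 :: "('o, 'm) cat"
  cells2 :: "('m, 't) cat"
  hcmp2 :: "'t \<Rightarrow> 't \<Rightarrow> 't"

definition equivalence_in :: "('o, 'm, 't) twocat \<Rightarrow> 'm \<Rightarrow> bool" where
  "equivalence_in K f \<longleftrightarrow>
     (let C = cells1 K; x = Dom C f; y = Cod C f in
      f \<in> Ar C \<and>
      (\<exists>g\<in>Hom C y x. isomorphic (cells2 K) (Id C x) (Cmp C f g) \<and>
                     isomorphic (cells2 K) (Cmp C g f) (Id C y)))"

text \<open>A condition on a 2-functor \<open>K \<rightarrow> L\<close> which only involves its action \<open>fo\<close> on objects and
  \<open>fm\<close> on 1-morphisms.\<close>

definition essentially_full_on_morphisms ::
  "('o, 'm, 't) twocat \<Rightarrow> ('p, 'n, 's) twocat \<Rightarrow> ('o \<Rightarrow> 'p) \<Rightarrow> ('m \<Rightarrow> 'n) \<Rightarrow> bool" where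
  "essentially_full_on_morphisms K L fo fm \<longleftrightarrow>
     (\<forall>x\<in>Ob (cells1 K). \<forall>y\<in>Ob (cells1 K). \<forall>g\<in>Hom (cells1 L) (fo x) (fo y).
        \<exists>f\<in>Hom (cells1 K) x y. isomorphic (cells2 L) (fm f) g)"

definition vertical_identity_sides :: "'a dbl \<Rightarrow> 'a \<Rightarrow> bool" where
  "vertical_identity_sides A \<alpha> \<longleftrightarrow>
     sq_left A \<alpha> \<in> Id (ver A) ` Obj A \<and> sq_right A \<alpha> \<in> Id (ver A) ` Obj A"

definition underlying_H :: "'a dbl \<Rightarrow> ('a, 'a, 'a) twocat" where
  "underlying_H A =
     \<lparr>cells1 = hor A,
      cells2 = (vsq A)\<lparr>Ar := {\<alpha> \<in> Sq A. vertical_identity_sides A \<alpha>}\<rparr>,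
      hcmp2 = Cmp (hsq A)\<rparr>"

definition dbl_transpose :: "'a dbl \<Rightarrow> 'a dbl" where
  "dbl_transpose A = \<lparr>hor = ver A, ver = hor A, hsq = vsq A, vsq = hsq A\<rparr>"

definition underlying_V :: "'a dbl \<Rightarrow> ('a, 'a, 'a) twocat" where
  "underlying_V A = underlying_H (dbl_transpose A)"


section \<open>Companion pairs and gregarious equivalences\<close>

type_synonym 'a quad = "'a \<times> 'a \<times> 'a \<times> 'a"

definition companion_pair :: "'a dbl \<Rightarrow> 'a quad \<Rightarrow> bool" where
  "companion_pair A = (\<lambda>(f, u, \<phi>, \<psi>).
     f \<in> HMor A \<and> u \<in> VMor A \<and>
     Dom (hor A) f = Dom (ver A) u \<and> Cod (hor A) f = Cod (ver A) u \<and>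
     (let a = Dom (hor A) f; b = Cod (hor A) f in
      \<phi> \<in> squares_with_boundary A f (Id (hor A) b) u (Id (ver A) b) \<and>
      \<psi> \<in> squares_with_boundary A (Id (hor A) a) f (Id (ver A) a) u) \<and>
     Cmp (hsq A) \<psi> \<phi> = Id (vsq A) f \<and>
     Cmp (vsq A) \<psi> \<phi> = Id (hsq A) u)"

text \<open>The companion pair on \<open>f\<close> followed by \<open>g\<close> has as its two squares the pastings
  \<open>(\<phi> | e\<^sub>g)\<close> above \<open>\<chi>\<close>, and \<open>\<psi>\<close> above \<open>(e\<^sub>f | \<omega>)\<close>. A 2-morphism of companion pairs is a
  square recorded together with its source and its target.\<close>

definition companion_2cat :: "'a dbl \<Rightarrow> ('a, 'a quad, 'a quad \<times> 'a \<times> 'a quad) twocat" where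
  "companion_2cat A =
     (let C =
        \<lparr>Ob = Obj A,
         Ar = {p. companion_pair A p},
         Dom = (\<lambda>(f, u, \<phi>, \<psi>). Dom (hor A) f),
         Cod = (\<lambda>(f, u, \<phi>, \<psi>). Cod (hor A) f),
         Id = (\<lambda>x. (Id (hor A) x, Id (ver A) x,
                     Id (vsq A) (Id (hor A) x), Id (vsq A) (Id (hor A) x))),
         Cmp = (\<lambda>(f, u, \<phi>, \<psi>) (g, v, \<chi>, \<omega>).
                  (Cmp (hor A) f g, Cmp (ver A) u v,
                   Cmp (vsq A) (Cmp (hsq A) \<phi> (Id (vsq A) g)) \<chi>,
                   Cmp (vsq A) \<psi> (Cmp (hsq A) (Id (vsq A) f) \<omega>)))\<rparr>
      in
        \<lparr>cells1 = C,
         cells2 =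
           \<lparr>Ob = {p. companion_pair A p},
            Ar = {(p, \<alpha>, q). companion_pair A p \<and> companion_pair A q \<and> \<alpha> \<in> Sq A \<and>
                    sq_top A \<alpha> = fst p \<and> sq_bot A \<alpha> = fst q \<and> vertical_identity_sides A \<alpha>},
            Dom = (\<lambda>(p, \<alpha>, q). p),
            Cod = (\<lambda>(p, \<alpha>, q). q),
            Id = (\<lambda>p. (p, Id (vsq A) (fst p), p)),
            Cmp = (\<lambda>(p, \<alpha>, q) (p', \<beta>, q'). (p, Cmp (vsq A) \<alpha> \<beta>, q'))\<rparr>,
         hcmp2 = (\<lambda>(p, \<alpha>, q) (p', \<beta>, q'). (Cmp C p p', Cmp (hsq A) \<alpha> \<beta>, Cmp C q q'))\<rparr>)"

definition gregarious_equivalence :: "'a dbl \<Rightarrow> 'a \<Rightarrow> 'a \<Rightarrow> 'a quad \<Rightarrow> bool" where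
  "gregarious_equivalence A x y p \<longleftrightarrow>
     p \<in> Hom (cells1 (companion_2cat A)) x y \<and> equivalence_in (companion_2cat A) p"

definition gregarious_double_equivalence :: "'a dfun \<Rightarrow> bool" where
  "gregarious_double_equivalence F \<longleftrightarrow>
     (\<forall>b\<in>Obj (target F). \<exists>a\<in>Obj (source F). \<exists>p.
        gregarious_equivalence (target F) (on_ob F a) b p) \<and>
     essentially_full_on_morphisms (underlying_H (source F)) (underlying_H (target F))
       (on_ob F) (on_hor F) \<and>
     essentially_full_on_morphisms (underlying_V (source F)) (underlying_V (target F))
       (on_ob F) (on_ver F) \<and>
     fully_faithful_on_squares F"


section \<open>The model structure \<open>DblCat\<^sub>c\<^sub>t\<^sub>r\<close>\<close>

text \<open>A model structure is determined by its trivial fibrations and its fibrant objects, hence at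
  most one \<open>M\<close> satisfies this predicate.\<close>

definition is_DblCat_ctr :: "'a set set \<Rightarrow> 'a dfun model \<Rightarrow> bool" where
  "is_DblCat_ctr \<U> M \<longleftrightarrow>
     model_structure (DblCat \<U>) M \<and>
     tfib M = canonical_trivial_fibrations \<U> \<and>
     (\<forall>A\<in>Ob (DblCat \<U>). fibrant (DblCat \<U>) M A \<longleftrightarrow>
        (\<exists>t F. terminal (DblCat \<U>) t \<and> F \<in> Hom (DblCat \<U>) A t \<and> gregarious_double_equivalence F))"

end

theory Submission
  imports Defs
begin

text \<open>
  A double category is fibrant in \<open>DblCat\<^sub>c\<^sub>t\<^sub>r\<close> only if its map to the terminal double category is a
  gregarious double equivalence. As the terminal double category has a single cell of each kind,
  that map is then a canonical trivial fibration. Fibrant replacement therefore makes every map to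
  the terminal object a weak equivalence, and by two-out-of-three every double functor is one. Hence
  every cofibration of \<open>DblCat\<^sub>c\<^sub>t\<^sub>r\<close> is trivial, and the cofibrations of the two model structures
  agree because their trivial fibrations do.
\<close>

section \<open>Categories and model structures\<close>

lemma category_Hom:
  assumes "is_category C"
  shows "f \<in> Ar C \<Longrightarrow> Dom C f \<in> Ob C" "f \<in> Ar C \<Longrightarrow> Cod C f \<in> Ob C"
    "x \<in> Ob C \<Longrightarrow> Id C x \<in> Hom C x x"
    "f \<in> Hom C x y \<Longrightarrow> g \<in> Hom C y z \<Longrightarrow> Cmp C f g \<in> Hom C x z"
  using assms by (auto simp: is_category_def Hom_def)

lemma category_laws:
  assumes "is_category C"
  shows "f \<in> Hom C x y \<Longrightarrow> Cmp C (Id C x) f = f" "f \<in> Hom C x y \<Longrightarrow> Cmp C f (Id C y) = f"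
    "f \<in> Hom C x y \<Longrightarrow> g \<in> Hom C y z \<Longrightarrow> h \<in> Hom C z w \<Longrightarrow>
      Cmp C (Cmp C f g) h = Cmp C f (Cmp C g h)"
  using assms by (auto simp: is_category_def Hom_def)

lemma adjunction_identity:
  assumes C: "is_category C"
  shows "adjunction C C (identity_adjunction C)"
  using C by (simp add: adjunction_def identity_adjunction_def is_functor_def is_category_def Hom_def)
    metis

text \<open>The filler is \<open>v\<close> followed by the inverse \<open>j\<close>: the lower
  triangle is \<open>Cmp C j i = Id C y\<close>, the upper one comes from the commuting square and
  \<open>Cmp C i j = Id C x\<close>.\<close>

lemma has_lifting_iso:
  assumes C: "is_category C" and l: "l \<in> Ar C"
    and i: "i \<in> Hom C x y" and j: "j \<in> Hom C y x"
    and ij: "Cmp C i j = Id C x" and ji: "Cmp C j i = Id C y"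
  shows "has_lifting C l i"
proof -
  have dom: "Dom C i = x" "Cod C i = y" using i by (auto simp: Hom_def)
  have l': "l \<in> Hom C (Dom C l) (Cod C l)" using l by (simp add: Hom_def)
  show ?thesis
    unfolding has_lifting_def dom
  proof (intro ballI impI bexI conjI)
    fix u v
    assume u: "u \<in> Hom C (Dom C l) x" and v: "v \<in> Hom C (Cod C l) y"
      and sq: "Cmp C u i = Cmp C l v"
    show "Cmp C v j \<in> Hom C (Cod C l) x"
      using category_Hom(4)[OF C v j] .
    have "Cmp C l (Cmp C v j) = Cmp C (Cmp C u i) j"
      using category_laws(3)[OF C l' v j] sq by simp
    then show "Cmp C l (Cmp C v j) = u"
      using category_laws(3)[OF C u i j] category_laws(2)[OF C u] ij by simp
    show "Cmp C (Cmp C v j) i = v"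
      using category_laws(3)[OF C v j i] category_laws(2)[OF C v] ji by simp
  qed
qed

text \<open>Trivial fibrations are exactly the arrows that lift against all cofibrations, and an
  isomorphism lifts against every arrow, so it is even a trivial fibration.\<close>

lemma iso_weq:
  assumes "is_category C" and M: "model_structure C M"
    and "i \<in> Hom C x y" "j \<in> Hom C y x" "Cmp C i j = Id C x" "Cmp C j i = Id C y"
  shows "i \<in> weq M"
proof -
  have wfs: "weak_factorization_system C (cof M) (tfib M)"
    using M by (simp add: model_structure_def)
  then have "cof M \<subseteq> Ar C" and
    R: "tfib M = {r \<in> Ar C. \<forall>l\<in>cof M. has_lifting C l r}"
    unfolding weak_factorization_system_def by (blast, metis)
  then have "\<forall>l\<in>cof M. has_lifting C l i"
    using has_lifting_iso[OF assms(1) _ assms(3-6)] \<open>cof M \<subseteq> Ar C\<close> by blast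
  then show ?thesis
    using R assms(3) by (auto simp: Hom_def)
qed

lemma terminal_unique:
  "terminal C t \<Longrightarrow> x \<in> Ob C \<Longrightarrow> f \<in> Hom C x t \<Longrightarrow> g \<in> Hom C x t \<Longrightarrow> f = g"
  unfolding terminal_def by blast

text \<open>Left lifting against the trivial fibrations characterises cofibrations, so the one class
  determines the other.\<close>

lemma cof_eq_if_tfib_eq:
  assumes "model_structure C M" "model_structure C N" "tfib M = tfib N"
  shows "cof M = cof N"
proof -
  have "cof K = {l \<in> Ar C. \<forall>r\<in>tfib K. has_lifting C l r}" if "model_structure C K" for K
    using that unfolding model_structure_def weak_factorization_system_def by blast
  from this[OF assms(1)] this[OF assms(2)] show ?thesis using assms(3) by simp
qed

text \<open>Once every map into \<open>t\<close> is a weak equivalence, two-out-of-three gives the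
  rest. The terminal object in \<open>contractible\<close> may vary with \<open>x\<close>, because
  \<open>fibrant\<close> itself quantifies over terminal objects.\<close>

lemma weq_eq_Ar_if_fibrants_contractible:
  assumes C: "is_category C" and M: "model_structure C M" and t: "terminal C t"
    and contractible: "\<And>x. x \<in> Ob C \<Longrightarrow> fibrant C M x \<Longrightarrow>
      \<exists>t' f. terminal C t' \<and> f \<in> Hom C x t' \<and> f \<in> weq M"
  shows "weq M = Ar C"
proof -
  have two_of_three: "Cmp C f g \<in> weq M" if "f \<in> weq M" "g \<in> weq M"
      "f \<in> Hom C x y" "g \<in> Hom C y z" for f g x y z
    using M that by (auto simp: model_structure_def Hom_def)
  have two_of_three': "f \<in> weq M" if "g \<in> weq M" "Cmp C f g \<in> weq M"
      "f \<in> Hom C x y" "g \<in> Hom C y z" for f g x y z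
    using M that by (auto simp: model_structure_def Hom_def)
  have to_t: "f \<in> weq M" if f: "f \<in> Hom C x t" for f x
  proof -
    have x: "x \<in> Ob C" using f category_Hom(1)[OF C] by (auto simp: Hom_def)
    have f': "f \<in> Ar C" using f by (simp add: Hom_def)
    have wfs: "weak_factorization_system C (tcof M) (fib M)"
      using M by (simp add: model_structure_def)
    \<comment> \<open>A trivial cofibration \<open>l\<close> followed by a fibration
      \<open>r\<close> makes the middle object a fibrant replacement of \<open>x\<close>.\<close>
    then obtain l r where l: "l \<in> tcof M" and r: "r \<in> fib M" "Cod C l = Dom C r" "Cmp C l r = f"
      using f' unfolding weak_factorization_system_def by blast
    have ar: "l \<in> Ar C" "r \<in> Ar C"
      using wfs l r unfolding weak_factorization_system_def by blast+
    define y where "y = Dom C r"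
    have lr0: "l \<in> Hom C (Dom C l) y" "r \<in> Hom C y (Cod C r)"
      using ar r(2) by (auto simp: Hom_def y_def)
    then have "f \<in> Hom C (Dom C l) (Cod C r)"
      using category_Hom(4)[OF C] r(3) by blast
    then have lr: "l \<in> Hom C x y" "r \<in> Hom C y t"
      using f lr0 by (auto simp: Hom_def)
    have y: "y \<in> Ob C" using category_Hom(1)[OF C ar(2)] by (simp add: y_def)
    have "fibrant C M y" using t lr r(1) by (auto simp: fibrant_def)
    then obtain t' h where t': "terminal C t'" and h: "h \<in> Hom C y t'" "h \<in> weq M"
      using contractible y by blast
    have ob: "t \<in> Ob C" "t' \<in> Ob C" using t t' by (auto simp: terminal_def)
    \<comment> \<open>Any two terminal objects are isomorphic; \<open>i\<close> carries the weak
      equivalence \<open>h\<close> from \<open>t'\<close> over to the fixed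
      \<open>t\<close>.\<close>
    obtain i j where i: "i \<in> Hom C t' t" and j: "j \<in> Hom C t t'"
      using t t' ob unfolding terminal_def by blast
    have "Cmp C i j = Id C t'"
      by (rule terminal_unique[OF t' ob(2) category_Hom(4)[OF C i j] category_Hom(3)[OF C ob(2)]])
    moreover have "Cmp C j i = Id C t"
      by (rule terminal_unique[OF t ob(1) category_Hom(4)[OF C j i] category_Hom(3)[OF C ob(1)]])
    ultimately have "i \<in> weq M" by (rule iso_weq[OF C M i j])
    then have "Cmp C h i \<in> weq M" using two_of_three h i by blast
    then have "Cmp C l (Cmp C h i) \<in> weq M"
      using two_of_three[of l, OF _ _ lr(1) category_Hom(4)[OF C h(1) i]] l by blast
    \<comment> \<open>This composite and \<open>f\<close> both go from \<open>x\<close> to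
      \<open>t\<close>, so they are equal.\<close>
    moreover have "Cmp C l (Cmp C h i) \<in> Hom C x t"
      by (rule category_Hom(4)[OF C lr(1) category_Hom(4)[OF C h(1) i]])
    ultimately show ?thesis
      using terminal_unique[OF t x f] by metis
  qed
  have "f \<in> weq M" if f: "f \<in> Ar C" for f
  proof -
    have hom: "f \<in> Hom C (Dom C f) (Cod C f)" using f by (simp add: Hom_def)
    obtain g where g: "g \<in> Hom C (Cod C f) t"
      using t category_Hom(2)[OF C f] unfolding terminal_def by blast
    \<comment> \<open>Both \<open>g\<close> and \<open>f\<close> followed by \<open>g\<close> end at
      \<open>t\<close>, so two-out-of-three cancels \<open>g\<close>.\<close>
    show ?thesis
      by (rule two_of_three'[OF to_t[OF g] to_t[OF category_Hom(4)[OF C hom g]] hom g])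
  qed
  then show ?thesis
    using M by (auto simp: model_structure_def)
qed

section \<open>The category of double categories\<close>

lemma is_functor_identity:
  assumes "is_category C"
  shows "is_functor C C (\<lambda>x\<in>Ob C. x) (\<lambda>f\<in>Ar C. f)"
  using assms by (auto simp: is_functor_def is_category_def Hom_def)

lemma is_functor_compose:
  assumes "is_category C" "is_functor C D fo fa" "is_functor D E go ga"
  shows "is_functor C E (compose (Ob C) go fo) (compose (Ar C) ga fa)"
  using assms by (auto simp: is_functor_def is_category_def Hom_def compose_def)

lemma double_functor_maps:
  assumes "double_functor F"
  shows "x \<in> Obj (source F) \<Longrightarrow> on_ob F x \<in> Obj (target F)"
    "f \<in> HMor (source F) \<Longrightarrow> on_hor F f \<in> HMor (target F)"
    "u \<in> VMor (source F) \<Longrightarrow> on_ver F u \<in> VMor (target F)"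
    "s \<in> Sq (source F) \<Longrightarrow> on_sq F s \<in> Sq (target F)"
  using assms by (auto simp: double_functor_def is_functor_def Hom_def)

text \<open>Components are \<open>undefined\<close> off their carriers, so agreement on the cells of
  the source forces equality of records.\<close>

lemma dfun_eqI:
  assumes "double_functor F" "double_functor G" "source F = source G" "target F = target G"
    and "\<And>x. x \<in> Obj (source F) \<Longrightarrow> on_ob F x = on_ob G x"
    and "\<And>f. f \<in> HMor (source F) \<Longrightarrow> on_hor F f = on_hor G f"
    and "\<And>u. u \<in> VMor (source F) \<Longrightarrow> on_ver F u = on_ver G u"
    and "\<And>s. s \<in> Sq (source F) \<Longrightarrow> on_sq F s = on_sq G s"
  shows "F = G"
proof -
  have "on_ob F = on_ob G" "on_hor F = on_hor G" "on_ver F = on_ver G" "on_sq F = on_sq G"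
    using assms by (auto simp: double_functor_def intro: extensionalityI)
  then show ?thesis using assms(3,4) by (cases F, cases G) auto
qed

lemma double_categoryD:
  assumes "double_category A"
  shows "is_category (hor A)" "is_category (ver A)" "is_category (hsq A)" "is_category (vsq A)"
    "Ob (ver A) = Obj A" "Ob (hsq A) = VMor A" "Ob (vsq A) = HMor A" "Ar (hsq A) = Sq A"
  using assms by (auto simp: double_category_def)

lemma double_functor_Id:
  assumes "double_category A"
  shows "double_functor (Id (DblCat \<U>) A)"
  using assms double_categoryD[OF assms] is_functor_identity[of "hor A"]
    is_functor_identity[of "ver A"] is_functor_identity[of "hsq A"] is_functor_identity[of "vsq A"]
  by (simp add: DblCat_def double_functor_def)

lemma double_functor_Cmp:
  assumes "double_category (source F)" "double_functor F" "double_functor G" "target F = source G"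
  shows "double_functor (Cmp (DblCat \<U>) F G)"
proof -
  note d = double_categoryD[OF assms(1)]
  have F: "is_functor (hor (source F)) (hor (source G)) (on_ob F) (on_hor F)"
    "is_functor (ver (source F)) (ver (source G)) (on_ob F) (on_ver F)"
    "is_functor (hsq (source F)) (hsq (source G)) (on_ver F) (on_sq F)"
    "is_functor (vsq (source F)) (vsq (source G)) (on_hor F) (on_sq F)"
    using assms(2,4) by (auto simp: double_functor_def)
  have G: "is_functor (hor (source G)) (hor (target G)) (on_ob G) (on_hor G)"
    "is_functor (ver (source G)) (ver (target G)) (on_ob G) (on_ver G)"
    "is_functor (hsq (source G)) (hsq (target G)) (on_ver G) (on_sq G)"
    "is_functor (vsq (source G)) (vsq (target G)) (on_hor G) (on_sq G)"
    using assms(3) by (auto simp: double_functor_def)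
  \<comment> \<open>The composites are restricted to \<open>Ob\<close> and \<open>Ar\<close> of the
    four categories; \<open>d(5-8)\<close> identify these sets with the carriers of the double
    category.\<close>
  show ?thesis
    using is_functor_compose[OF d(1) F(1) G(1)] is_functor_compose[OF d(2) F(2) G(2)]
      is_functor_compose[OF d(3) F(3) G(3)] is_functor_compose[OF d(4) F(4) G(4)]
    by (simp add: DblCat_def double_functor_def d(5-8) compose_def)
qed

lemma is_category_DblCat: "is_category (DblCat \<U>)"
proof -
  let ?C = "DblCat \<U>"
  have Ar: "F \<in> Ar ?C \<longleftrightarrow> double_functor F \<and> source F \<in> Ob ?C \<and> target F \<in> Ob ?C" for F
    by (auto simp: DblCat_def)
  have st [simp]: "Dom ?C = source" "Cod ?C = target"
    "source (Id ?C A) = A" "target (Id ?C A) = A"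
    "source (Cmp ?C F G) = source F" "target (Cmp ?C F G) = target G" for A F G
    by (simp_all add: DblCat_def)
  have dc: "double_category A" if "A \<in> Ob ?C" for A
    using that by (simp add: DblCat_def)
  have Id: "Id ?C A \<in> Ar ?C" if "A \<in> Ob ?C" for A
    using that double_functor_Id[OF dc[OF that]] by (simp add: Ar)
  have Cmp: "Cmp ?C F G \<in> Ar ?C" if "F \<in> Ar ?C" "G \<in> Ar ?C" "target F = source G" for F G
    using that double_functor_Cmp[of F G \<U>] dc by (simp add: Ar)
  have left: "Cmp ?C (Id ?C (source F)) F = F" if F: "F \<in> Ar ?C" for F
  proof (rule dfun_eqI)
    show "double_functor (Cmp ?C (Id ?C (source F)) F)" "double_functor F"
      using F Cmp Id by (simp_all add: Ar)
  qed (simp_all add: DblCat_def compose_def)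
  \<comment> \<open>The identity is restricted to the carriers of the target, so cancelling it
    relies on \<open>F\<close> mapping cells into them.\<close>
  have right: "Cmp ?C F (Id ?C (target F)) = F" if F: "F \<in> Ar ?C" for F
  proof (rule dfun_eqI)
    show "double_functor (Cmp ?C F (Id ?C (target F)))" and F': "double_functor F"
      using F Cmp Id by (simp_all add: Ar)
  qed (use F double_functor_maps[of F] in \<open>simp_all add: DblCat_def compose_def\<close>)
  have assoc: "Cmp ?C (Cmp ?C F G) H = Cmp ?C F (Cmp ?C G H)"
    if "F \<in> Ar ?C" "G \<in> Ar ?C" "H \<in> Ar ?C" "target F = source G" "target G = source H" for F G H
  proof (rule dfun_eqI)
    show "double_functor (Cmp ?C (Cmp ?C F G) H)" "double_functor (Cmp ?C F (Cmp ?C G H))"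
      using that Cmp by (simp_all add: Ar)
  qed (use that double_functor_maps[of F] in \<open>simp_all add: DblCat_def compose_def\<close>)
  show ?thesis
    using Id Cmp left right assoc by (auto simp: is_category_def Hom_def Ar)
qed

section \<open>The terminal double category\<close>

definition point_cat :: "'a \<Rightarrow> ('a, 'a) cat" where
  "point_cat a = \<lparr>Ob = {a}, Ar = {a}, Dom = (\<lambda>_. a), Cod = (\<lambda>_. a), Id = (\<lambda>_. a), Cmp = (\<lambda>_ _. a)\<rparr>"

text \<open>One element serves as object, morphism of either direction and square, since the sorts
  of cells may overlap; smallness then reduces to \<open>{a} \<in> \<U>\<close>.\<close>

definition point_dbl :: "'a \<Rightarrow> 'a dbl" where
  "point_dbl a = \<lparr>hor = point_cat a, ver = point_cat a, hsq = point_cat a, vsq = point_cat a\<rparr>"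

lemma double_category_point: "double_category (point_dbl a)"
  by (auto simp: double_category_def point_dbl_def point_cat_def is_category_def is_functor_def
      Hom_def horizontally_composable_pairs_def)

text \<open>Only constant maps land in one-element carriers, and they respect all the
  structure.\<close>

lemma terminal_point:
  assumes a: "{a} \<in> \<U>"
  shows "terminal (DblCat \<U>) (point_dbl a)"
  unfolding terminal_def
proof (intro conjI ballI)
  let ?C = "DblCat \<U>" and ?P = "point_dbl a"
  show P: "?P \<in> Ob ?C"
    using a double_category_point by (simp add: DblCat_def small_def point_dbl_def point_cat_def)
  fix A assume A: "A \<in> Ob ?C"
  let ?F = "\<lparr>source = A, target = ?P, on_ob = (\<lambda>x\<in>Obj A. a), on_hor = (\<lambda>f\<in>HMor A. a),
    on_ver = (\<lambda>u\<in>VMor A. a), on_sq = (\<lambda>s\<in>Sq A. a)\<rparr>"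
  have dc: "double_category A" using A by (simp add: DblCat_def)
  have F: "double_functor ?F"
    using double_categoryD[OF dc]
    by (auto simp: double_functor_def is_functor_def Hom_def is_category_def
        point_dbl_def point_cat_def)
  show "\<exists>!F. F \<in> Hom ?C A ?P"
  proof (rule ex1I)
    show "?F \<in> Hom ?C A ?P"
      using F A P by (simp add: Hom_def DblCat_def)
    fix G assume "G \<in> Hom ?C A ?P"
    then have G: "double_functor G" "source G = A" "target G = ?P"
      by (auto simp: Hom_def DblCat_def)
    show "G = ?F"
      by (rule dfun_eqI[OF G(1) F])
        (use G double_functor_maps[OF G(1)] in \<open>simp_all add: point_dbl_def point_cat_def\<close>)
  qed
qed

text \<open>A constant map sends an infinite, hence nonempty, small set onto a singleton.\<close>

lemma universe_singleton:
  fixes a :: 'a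
  assumes "universe \<U>"
  shows "{a} \<in> \<U>"
proof -
  note U = assms[unfolded universe_def]
  obtain X where X: "X \<in> \<U>" "infinite X" using U[THEN conjunct1] by blast
  note image = U[THEN conjunct2, THEN conjunct2, THEN conjunct1]
  have "(\<lambda>_. a) ` X \<in> \<U>" using image X(1) by simp
  moreover have "(\<lambda>_. a) ` X = {a}" using X(2) by (auto simp: image_constant_conv)
  ultimately show ?thesis by simp
qed

text \<open>By terminality the composite of \<open>L\<close> to the point and \<open>K\<close> back
  to \<open>t\<close> is the identity. As \<open>L\<close> collapses each sort of cell to one value,
  \<open>t\<close> has at most one cell of each sort.\<close>

lemma terminal_DblCat_cells:
  assumes \<U>: "universe \<U>" and t: "terminal (DblCat \<U>) t"
  shows "x \<in> Obj t \<Longrightarrow> y \<in> Obj t \<Longrightarrow> x = y" "f \<in> HMor t \<Longrightarrow> g \<in> HMor t \<Longrightarrow> f = g"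
    "u \<in> VMor t \<Longrightarrow> v \<in> VMor t \<Longrightarrow> u = v"
proof -
  let ?C = "DblCat \<U>" and ?P = "point_dbl undefined"
  note C = is_category_DblCat[of \<U>]
  have P: "terminal ?C ?P" by (rule terminal_point[OF universe_singleton[OF \<U>]])
  have ob: "t \<in> Ob ?C" "?P \<in> Ob ?C" using P t by (auto simp: terminal_def)
  obtain K L where K: "K \<in> Hom ?C ?P t" and L: "L \<in> Hom ?C t ?P"
    using P t ob unfolding terminal_def by blast
  have "Cmp ?C L K = Id ?C t"
    by (rule terminal_unique[OF t ob(1) category_Hom(4)[OF C L K] category_Hom(3)[OF C ob(1)]])
  moreover have src: "source L = t" "target L = ?P" "double_functor L"
    using L by (auto simp: Hom_def DblCat_def)
  ultimately have
    "compose (Obj t) (on_ob K) (on_ob L) = (\<lambda>x\<in>Obj t. x)"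
    "compose (HMor t) (on_hor K) (on_hor L) = (\<lambda>x\<in>HMor t. x)"
    "compose (VMor t) (on_ver K) (on_ver L) = (\<lambda>x\<in>VMor t. x)"
    by (auto simp: DblCat_def)
  then have KL:
    "x \<in> Obj t \<Longrightarrow> on_ob K (on_ob L x) = x"
    "x \<in> HMor t \<Longrightarrow> on_hor K (on_hor L x) = x"
    "x \<in> VMor t \<Longrightarrow> on_ver K (on_ver L x) = x" for x
    by (auto simp: compose_def dest: fun_cong[of _ _ x])
  \<comment> \<open>Here \<open>undefined\<close> is the only cell of
    \<open>point_dbl undefined\<close>, not the value taken off a carrier.\<close>
  have L': "x \<in> Obj t \<Longrightarrow> on_ob L x = undefined"
    "x \<in> HMor t \<Longrightarrow> on_hor L x = undefined"
    "x \<in> VMor t \<Longrightarrow> on_ver L x = undefined" for x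
    using double_functor_maps[OF src(3)] src by (auto simp: point_dbl_def point_cat_def)
  show "x \<in> Obj t \<Longrightarrow> y \<in> Obj t \<Longrightarrow> x = y" "f \<in> HMor t \<Longrightarrow> g \<in> HMor t \<Longrightarrow> f = g"
    "u \<in> VMor t \<Longrightarrow> v \<in> VMor t \<Longrightarrow> u = v"
    using KL(1)[of x] KL(1)[of y] KL(2)[of f] KL(2)[of g] KL(3)[of u] KL(3)[of v] L'
    by auto
qed

section \<open>Contractibility of the fibrant objects\<close>

lemma essentially_full_on_morphismsE:
  assumes "essentially_full_on_morphisms K L fo fm" "x \<in> Ob (cells1 K)" "y \<in> Ob (cells1 K)"
    and "g \<in> Hom (cells1 L) (fo x) (fo y)"
  obtains f where "f \<in> Hom (cells1 K) x y"
  using assms unfolding essentially_full_on_morphisms_def by blast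

text \<open>Both notions share full faithfulness on squares; their other conditions ask for lifts up
  to equivalence or for strict lifts. In \<open>t\<close> all objects coincide, and so do all
  morphisms of each direction, so every lift is strict.\<close>

lemma canonical_if_gregarious_to_terminal:
  assumes \<U>: "universe \<U>" and t: "terminal (DblCat \<U>) t"
    and F: "F \<in> Hom (DblCat \<U>) A t" and greg: "gregarious_double_equivalence F"
  shows "canonical_trivial_fibration F"
proof -
  have tgt: "target F = t" and src: "source F = A" and F': "double_functor F"
    using F by (auto simp: Hom_def DblCat_def)
  note maps = double_functor_maps[OF F', unfolded src tgt]
  note cells = terminal_DblCat_cells[OF \<U> t]
  \<comment> \<open>A gregarious equivalence into an object of \<open>t\<close> starts at the image
    of an object of \<open>A\<close>.\<close>
  have inhabited: "\<forall>b\<in>Obj t. \<exists>a. a \<in> Obj A"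
    using greg unfolding gregarious_double_equivalence_def src tgt by blast
  have essH: "essentially_full_on_morphisms (underlying_H A) (underlying_H t) (on_ob F) (on_hor F)"
    and essV: "essentially_full_on_morphisms (underlying_V A) (underlying_V t) (on_ob F) (on_ver F)"
    using greg unfolding gregarious_double_equivalence_def src tgt by blast+
  have "on_ob F ` Obj A = Obj t"
    using inhabited maps(1) cells(1) by blast
  moreover have "full (hor A) (hor t) (on_ob F) (on_hor F)"
    unfolding full_def
  proof (intro ballI subsetI)
    fix x y g assume x: "x \<in> Obj A" "y \<in> Obj A" and g: "g \<in> Hom (hor t) (on_ob F x) (on_ob F y)"
    obtain f where f: "f \<in> Hom (hor A) x y"
      using essentially_full_on_morphismsE[OF essH, of x y g] x g by (auto simp: underlying_H_def)
    then have "g = on_hor F f" using g maps(2) cells(2) by (auto simp: Hom_def)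
    then show "g \<in> on_hor F ` Hom (hor A) x y" using f by blast
  qed
  moreover have "full (ver A) (ver t) (on_ob F) (on_ver F)"
    unfolding full_def
  proof (intro ballI subsetI)
    fix x y g assume x: "x \<in> Ob (ver A)" "y \<in> Ob (ver A)"
      and g: "g \<in> Hom (ver t) (on_ob F x) (on_ob F y)"
    \<comment> \<open>As \<open>underlying_V\<close> is \<open>underlying_H\<close> of the
      transpose, its 1-morphisms are those of \<open>ver A\<close>.\<close>
    obtain f where f: "f \<in> Hom (ver A) x y"
      using essentially_full_on_morphismsE[OF essV, of x y g] x g
      by (auto simp: underlying_V_def underlying_H_def dbl_transpose_def)
    then have "g = on_ver F f" using g maps(3) cells(3) by (auto simp: Hom_def)
    then show "g \<in> on_ver F ` Hom (ver A) x y" using f by blast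
  qed
  ultimately show ?thesis
    using greg by (simp add: canonical_trivial_fibration_def gregarious_double_equivalence_def src tgt)
qed

section \<open>Weak equivalences and the localization\<close>

text \<open>Canonical trivial fibrations are trivial fibrations of \<open>M\<close>, so the
  gregarious map from a fibrant object to a terminal one supplies the contractibility asked for by
  \<open>weq_eq_Ar_if_fibrants_contractible\<close>.\<close>

lemma weq_DblCat_ctr:
  assumes \<U>: "universe \<U>" and ctr: "is_DblCat_ctr \<U> M"
  shows "weq M = Ar (DblCat \<U>)"
proof (rule weq_eq_Ar_if_fibrants_contractible)
  show "is_category (DblCat \<U>)" by (rule is_category_DblCat)
  show "terminal (DblCat \<U>) (point_dbl undefined)"
    by (rule terminal_point[OF universe_singleton[OF \<U>]])
  show "model_structure (DblCat \<U>) M" using ctr by (simp add: is_DblCat_ctr_def)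
  fix A assume "A \<in> Ob (DblCat \<U>)" "fibrant (DblCat \<U>) M A"
  then obtain t F where tF: "terminal (DblCat \<U>) t" "F \<in> Hom (DblCat \<U>) A t"
    "gregarious_double_equivalence F"
    using ctr unfolding is_DblCat_ctr_def by blast
  then have "F \<in> canonical_trivial_fibrations \<U>"
    using canonical_if_gregarious_to_terminal[OF \<U>]
    by (simp add: canonical_trivial_fibrations_def Hom_def)
  then have "F \<in> weq M" using ctr by (auto simp: is_DblCat_ctr_def)
  then show "\<exists>t f. terminal (DblCat \<U>) t \<and> f \<in> Hom (DblCat \<U>) A t \<and> f \<in> weq M"
    using tF by blast
qed

theorem proposition8p11:
  fixes \<U> :: "'a set set"
    and Mctr M :: "'a dfun model"
  assumes "universe \<U>"
    and "is_DblCat_ctr \<U> Mctr"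
    and "model_structure (DblCat \<U>) M"
    and "tfib M = canonical_trivial_fibrations \<U>"
  shows "is_localization (DblCat \<U>) M Mctr"
proof -
  let ?C = "DblCat \<U>"
  note C = is_category_DblCat[of \<U>]
  have ctr: "model_structure ?C Mctr" "tfib Mctr = tfib M"
    using assms(2,4) by (simp_all add: is_DblCat_ctr_def)
  have weq: "weq Mctr = Ar ?C" by (rule weq_DblCat_ctr[OF assms(1,2)])
  have cof: "cof Mctr = cof M" using cof_eq_if_tfib_eq[OF ctr(1) assms(3) ctr(2)] .
  have "cof M \<subseteq> Ar ?C"
    using assms(3) unfolding model_structure_def weak_factorization_system_def by blast
  \<comment> \<open>The cofibrations agree and all of them are trivial in \<open>Mctr\<close>, so
    the identity preserves both classes.\<close>
  then have "quillen_pair ?C M ?C Mctr (identity_adjunction ?C)"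
    using adjunction_identity[OF C] cof weq
    by (auto simp: quillen_pair_def identity_adjunction_def)
  moreover have "derived_counit_weq ?C M ?C Mctr (identity_adjunction ?C)"
    unfolding derived_counit_weq_def
  proof (intro ballI impI)
    fix y q assume "y \<in> Ob ?C" and q: "q \<in> tfib M"
      "cofibrant ?C M (Dom ?C q) \<and> Cod ?C q = right_ob (identity_adjunction ?C) y"
    have "q \<in> Ar ?C" using q(1) assms(4) by (auto simp: canonical_trivial_fibrations_def)
    then have "q \<in> Hom ?C (Dom ?C q) y"
      using q(2) by (simp add: Hom_def identity_adjunction_def)
    \<comment> \<open>Both adjoints and the counit are identities, so the derived counit at
      \<open>y\<close> is the cofibrant replacement \<open>q\<close> itself.\<close>
    then have "Cmp ?C q (Id ?C y) = q" by (rule category_laws(2)[OF C])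
    then show "Cmp ?C (left_ar (identity_adjunction ?C) q) (counit (identity_adjunction ?C) y)
        \<in> weq Mctr"
      using \<open>q \<in> Ar ?C\<close> weq by (simp add: identity_adjunction_def)
  qed
  ultimately show ?thesis
    using assms(3) ctr by (simp add: is_localization_def)
qed

end
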